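(* Let $\widehat N=\begin{pmatrix}\widehat A&\widehat B\\ I&O\end{pmatrix}\in\mathbb{DC}_z^{n\times n}$, where $\widehat A$ and $\widehat B$ are square of the same order and dual Drazin invertible, with $\mathrm{Ind}_s(\widehat A)=i_{\widehat A}$ and $\mathrm{Ind}_s(\widehat B)=i_{\widehat B}$. Assume $\widehat A\widehat A^\pi\widehat B=\widehat B\widehat A\widehat A^\pi$ and $\widehat B\widehat A\widehat A^e=O$. Then $\widehat N^D=\begin{pmatrix}N_{11}&N_{12}\\ N_{21}&N_{22}\end{pmatrix}$ with $$N_{11}=\sum_{i=0}^{i_{\widehat B}-1}\widehat A^{(2i+1)D}\widehat B^\pi\widehat B^i,\qquad N_{12}=\widehat A^\pi\widehat B\widehat B^D+\sum_{i=0}^{i_{\widehat B}-1}\widehat A^{(2i+2)D}\widehat B^\pi\widehat B^{i+1},$$ $$N_{21}=\sum_{i=0}^{i_{\widehat B}-1}\widehat A^{(2i+2)D}\widehat B^\pi\widehat B^i+\widehat A^\pi\widehat B^D,$$ $$N_{22}=-\widehat A\widehat A^\pi\widehat B^D-\widehat A^D\widehat B^e+\sum_{i=0}^{i_{\widehat B}-1}\widehat A^{(2i+3)D}\widehat B^\pi\widehat B^{i+1}.$$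
   Context: Dual numbers: $\varepsilon\neq0$, $\varepsilon^2=0$, commuting with complex matrices. $\mathbb{DC}^{n\times n}$ denotes matrices $\widehat{A}=A+\varepsilon A_0$ with $A,A_0\in\mathbb{C}^{n\times n}$. For complex $A$, $\mathrm{Ind}(A)$ is the least $k\ge0$ with $\operatorname{rank}A^k=\operatorname{rank}A^{k+1}$ and $A^D$ its Drazin inverse. $\mathbb{DC}_z^{n\times n}$ is the set of $\widehat{A}=A+\varepsilon A_0$ with $(I-AA^D)\big(\sum_{i=1}^{k}A^{k-i}A_0A^{i-1}\big)(I-AA^D)=O$, $k=\mathrm{Ind}(A)$; "dual Drazin invertible" means belonging to this set. For such $\widehat A$, the dual Drazin inverse $\widehat A^D$ is the unique $\widehat X$ with $\widehat A^k\widehat X\widehat A=\widehat A^k$, $\widehat X\widehat A\widehat X=\widehat X$, $\widehat A\widehat X=\widehat X\widehat A$. $\mathrm{Ind}_s(\widehat A):=\mathrm{Ind}(A)$. $\widehat A^{sD}=(\widehat A^D)^s$, $\widehat A^e=\widehat A\widehat A^D$, $\widehat A^\pi=I-\widehat A^e$, $\widehat A^0=I$; empty sums are zero. *)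

theory Defs
  imports "HOL-Analysis.Analysis"
begin

section \<open>Dual complex numbers\<close>

text \<open>\<open>Dual a b\<close> is $a + \varepsilon b$.\<close>

datatype dual = Dual (std_part: complex) (inf_part: complex)

instantiation dual :: comm_ring_1
begin

definition "0 = Dual 0 0"
definition "1 = Dual 1 0"
definition "x + y = Dual (std_part x + std_part y) (inf_part x + inf_part y)"
definition "x - y = Dual (std_part x - std_part y) (inf_part x - inf_part y)"
definition "- x = Dual (- std_part x) (- inf_part x)"
definition "x * y = Dual (std_part x * std_part y) (std_part x * inf_part y + inf_part x * std_part y)"

instance
  by standard
    (auto simp: zero_dual_def one_dual_def plus_dual_def minus_dual_def uminus_dual_def
      times_dual_def algebra_simps)

end

definition eps :: dual
  where "eps = Dual 0 1"

lemma eps_nonzero: "eps \<noteq> 0" and eps_square: "eps * eps = 0"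
  by (simp_all add: eps_def zero_dual_def times_dual_def)

text \<open>A dual complex matrix is a matrix with entries in \<^typ>\<open>dual\<close>; \<open>mstd\<close> and \<open>minf\<close> are the
  complex matrices $A$ and $A_0$ of $A + \varepsilon A_0$.\<close>

definition mstd :: "dual^'n^'m \<Rightarrow> complex^'n^'m"
  where "mstd A = map_matrix std_part A"

definition minf :: "dual^'n^'m \<Rightarrow> complex^'n^'m"
  where "minf A = map_matrix inf_part A"

definition mdual :: "complex^'n^'m \<Rightarrow> dual^'n^'m"
  where "mdual A = map_matrix (\<lambda>z. Dual z 0) A"

lemma dual_matrix_decomp: "A = mdual (mstd A) + map_matrix ((*) eps) (mdual (minf A))"
  by (simp add: vec_eq_iff mdual_def mstd_def minf_def map_matrix_def eps_def
      plus_dual_def times_dual_def)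


section \<open>Powers and block matrices\<close>

text \<open>The library's \<open>^\<close> on \<^typ>\<open>'a^'n^'n\<close> is the entrywise power, so the matrix power is
  defined here.\<close>

primrec matpow :: "'a::semiring_1^'n^'n \<Rightarrow> nat \<Rightarrow> 'a^'n^'n"  (infixr \<open>**^\<close> 80)
  where
    "A **^ 0 = mat 1"
  | "A **^ Suc k = A ** (A **^ k)"

text \<open>$\left(\begin{array}{cc} A & B \cr C & D \end{array}\right)$\<close>

definition block_matrix ::
  "'a^'n^'n \<Rightarrow> 'a^'n^'n \<Rightarrow> 'a^'n^'n \<Rightarrow> 'a^'n^'n \<Rightarrow> 'a^('n::finite + 'n)^('n + 'n)"
  where "block_matrix A B C D =
    (\<chi> i j. case i of
        Inl i' \<Rightarrow> (case j of Inl j' \<Rightarrow> A $ i' $ j' | Inr j' \<Rightarrow> B $ i' $ j')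
      | Inr i' \<Rightarrow> (case j of Inl j' \<Rightarrow> C $ i' $ j' | Inr j' \<Rightarrow> D $ i' $ j'))"


section \<open>Drazin inverses\<close>

definition ind :: "complex^'n^'n \<Rightarrow> nat"
  where "ind A = (LEAST k. rank (A **^ k) = rank (A **^ (k + 1)))"

definition is_drazin_inverse ::
  "nat \<Rightarrow> 'a::comm_ring_1^'n^'n \<Rightarrow> 'a^'n^'n \<Rightarrow> bool"
  where "is_drazin_inverse k A X \<longleftrightarrow>
    (A **^ k) ** X ** A = A **^ k \<and> X ** A ** X = X \<and> A ** X = X ** A"

definition complex_drazin :: "complex^'n^'n \<Rightarrow> complex^'n^'n"
  where "complex_drazin A = (THE X. is_drazin_inverse (ind A) A X)"

definition ind_s :: "dual^'n^'n \<Rightarrow> nat"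
  where "ind_s A = ind (mstd A)"

definition dual_drazin_invertible :: "(dual^'n^'n) set"
  where "dual_drazin_invertible =
    {M. let A = mstd M; A0 = minf M; k = ind A; P = mat 1 - A ** complex_drazin A
        in P ** (\<Sum>i=1..k. (A **^ (k - i)) ** A0 ** (A **^ (i - 1))) ** P = 0}"

text \<open>\<open>A\<^sup>D\<close> is an unspecified matrix unless \<open>A \<in> dual_drazin_invertible\<close>.\<close>

definition dual_drazin :: "dual^'n^'n \<Rightarrow> dual^'n^'n"  (\<open>_\<^sup>D\<close> [1000] 1000)
  where "A\<^sup>D = (THE X. is_drazin_inverse (ind_s A) A X)"

definition dual_drazin_e :: "dual^'n^'n \<Rightarrow> dual^'n^'n"  (\<open>_\<^sup>e\<close> [1000] 1000)
  where "A\<^sup>e = A ** A\<^sup>D"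

definition dual_drazin_pi :: "dual^'n^'n \<Rightarrow> dual^'n^'n"  (\<open>_\<^sup>\<pi>\<close> [1000] 1000)
  where "A\<^sup>\<pi> = mat 1 - A\<^sup>e"

end

theory Submission
  imports Defs
begin

text \<open>A Drazin inverse is unique whatever exponent is used, so it suffices to check the equations
  for the displayed matrix with some exponent. An element \<open>a\<close> of a ring has a Drazin inverse with
  exponent \<open>k\<close> as soon as \<open>a ^ k \<in> R a ^ (k + 1)\<close> and \<open>a ^ l \<in> a ^ (l + 1) R\<close> for some \<open>l\<close>. For complex
  matrices this is the stabilisation of ranks; for dual matrices the two factorisations of \<open>A ^ k\<close>
  are solved order by order in \<open>\<epsilon>\<close>, and the defining condition of the class of dual Drazin invertible
  matrices is exactly their solvability.

  Write \<open>x\<close>, \<open>y\<close> for the Drazin inverses of \<open>a\<close>, \<open>b\<close>, \<open>p = 1 - a x\<close>, \<open>q = 1 - b y\<close>, and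
  \<open>s = \<Sum> x ^ (2 i + 1) q b ^ i\<close>, which satisfies \<open>s = x q + x\<^sup>2 s b\<close> and \<open>s b y = 0\<close>. The block entries
  are then \<open>s\<close>, \<open>p b y + x s b\<close>, \<open>x s + p y\<close> and \<open>s - x - a p y\<close>; commutation and the inner inverse
  equation are word computations in \<open>a, x, b, y, s\<close>. The remainder \<open>(1 - N V) N\<close> splits as \<open>C + D\<close>
  with \<open>C D = D\<^sup>2 = 0\<close>, where \<open>C\<close> has the blocks \<open>a p q\<close>, \<open>p q b\<close>, \<open>p q\<close>, \<open>0\<close> and satisfies
  \<open>C\<^sup>2 = U C + G\<close> with commuting nilpotent \<open>U = a p q\<close> and \<open>G = p q b\<close>. So it is nilpotent.\<close>

section \<open>Drazin inverses in rings\<close>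

context ring_1
begin

definition drazin :: "nat \<Rightarrow> 'a \<Rightarrow> 'a \<Rightarrow> bool"
  where "drazin k a x \<longleftrightarrow> a ^ k * x * a = a ^ k \<and> x * a * x = x \<and> a * x = x * a"

lemma drazin_mono:
  assumes "drazin k a x" "k \<le> n"
  shows "drazin n a x"
proof -
  have "a ^ n * x * a = a ^ (n - k) * (a ^ k * x * a)"
    using assms(2) by (metis le_add_diff_inverse2 mult.assoc power_add)
  with assms show ?thesis
    by (simp add: drazin_def flip: power_add)
qed

text \<open>Inserting \<open>a * x\<close> into \<open>x\<close> repeatedly puts \<open>x\<close>
  into \<open>R a ^ n\<close> and \<open>a ^ n R\<close> for every \<open>n\<close>, whatever
  \<open>k\<close> is.\<close>

lemma drazin_power_left:
  assumes "drazin k a x"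
  shows "x ^ Suc n * a ^ n = x" "a ^ n * x ^ Suc n = x"
proof -
  have *: "a * x = x * a" "x * a * x = x"
    using assms by (auto simp: drazin_def)
  have comm: "a ^ n * x = x * a ^ n" for n
    using * by (metis power_commuting_commutes)
  show "x ^ Suc n * a ^ n = x"
  proof (induction n)
    case (Suc n)
    have "x ^ Suc (Suc n) * a ^ Suc n = x * (x ^ Suc n * a ^ n) * a"
      by (simp add: mult.assoc power_commutes)
    also have "\<dots> = x"
      using Suc * by (metis mult.assoc)
    finally show ?case .
  qed simp
  then show "a ^ n * x ^ Suc n = x"
    using * by (metis power_commuting_commutes)
qed

text \<open>At a common exponent both inverses reduce to \<open>x * a * y\<close>: the powers of
  \<open>a\<close> extracted from \<open>x\<close> absorb \<open>y * a\<close>, those extracted from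
  \<open>y\<close> absorb \<open>x * a\<close>.\<close>

lemma drazin_unique:
  assumes "drazin k a x" "drazin l a y"
  shows "x = y"
proof -
  define n where "n = max k l"
  have x: "drazin n a x" and y: "drazin n a y"
    using assms by (auto simp: n_def intro: drazin_mono)
  have "x = x ^ Suc n * a ^ n"
    using drazin_power_left(1)[OF x] by simp
  also have "\<dots> = x ^ Suc n * a ^ n * y * a"
    using y by (metis drazin_def mult.assoc)
  also have "\<dots> = x * y * a"
    using drazin_power_left(1)[OF x] by simp
  finally have 1: "x = x * a * y"
    using y by (simp add: drazin_def mult.assoc)
  have "y = a ^ n * y ^ Suc n"
    using drazin_power_left(2)[OF y] by simp
  also have "\<dots> = x * a * (a ^ n * y ^ Suc n)"
    using x unfolding drazin_def by (metis mult.assoc power_commutes power_commuting_commutes)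
  also have "\<dots> = x * a * y"
    using drazin_power_left(2)[OF y] by simp
  finally show ?thesis
    using 1 by simp
qed

text \<open>Put \<open>e = a * x\<close>. Extracting \<open>a ^ k\<close> from \<open>x\<close>,
  moving it past \<open>c\<close> and using that \<open>1 - e\<close> kills \<open>a ^ k\<close> on
  both sides gives \<open>c * x = e * c * x\<close> and \<open>x * c = x * c * e\<close>. The
  right-hand sides agree because \<open>c\<close> commutes with \<open>a\<close>.\<close>

lemma drazin_commute:
  assumes x: "drazin k a x" and c: "c * a = a * c"
  shows "c * x = x * c"
proof -
  have ax: "a * x = x * a" "x * a * x = x" "a ^ k * (1 - a * x) = 0"
    using x by (auto simp: drazin_def algebra_simps)
  have ck: "c * a ^ k = a ^ k * c"
    using c by (metis power_commuting_commutes)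
  have "(1 - a * x) * a ^ k = 0"
    using ax by (metis left_diff_distrib mult.assoc mult_1_left mult_1_right
        power_commuting_commutes right_diff_distrib)
  then have "(1 - a * x) * c * x = 0"
    using ck drazin_power_left(2)[OF x, of k] by (metis mult.assoc mult_zero_left)
  moreover have "x * c * (1 - a * x) = 0"
    using ax ck drazin_power_left(1)[OF x, of k] by (metis mult.assoc mult_zero_right)
  moreover have "(1 - a * x) * c * x = c * x - a * x * c * x"
    "x * c * (1 - a * x) = x * c - x * c * a * x"
    by (simp_all add: left_diff_distrib right_diff_distrib mult.assoc)
  ultimately have "c * x = a * x * c * x" "x * c = x * c * a * x"
    by (metis right_minus_eq)+
  then show ?thesis
    using ax c by (metis mult.assoc)
qed

text \<open>For \<open>m > max k l\<close> the power \<open>b = a ^ m\<close> has the group inverse \<open>z ^ m * b * y ^ m\<close>, which commutes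
  with \<open>a\<close> because it lies in the double commutant of \<open>b\<close>.\<close>

lemma drazin_exists:
  assumes z: "a ^ k = z * a ^ Suc k" and y: "a ^ l = a ^ Suc l * y"
  shows "\<exists>x. drazin k a x"
proof -
  have Z: "a ^ k = z ^ n * a ^ (k + n)" for n
  proof (induction n)
    case (Suc n)
    have "z ^ Suc n = z ^ n * z" "a ^ (k + Suc n) = a ^ Suc k * a ^ n" "a ^ (k + n) = a ^ k * a ^ n"
      by (rule power_Suc2) (metis add_Suc_shift power_add, rule power_add)
    with Suc z show ?case
      by (metis mult.assoc)
  qed simp
  have Y: "a ^ l = a ^ n * a ^ l * y ^ n" for n
  proof (induction n)
    case (Suc n)
    have "a ^ Suc n * a ^ l * y ^ Suc n = a ^ n * (a ^ Suc l * y) * y ^ n"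
      unfolding power_Suc2[of a n] power_Suc[of a l] power_Suc[of y n] by (simp only: mult.assoc)
    then show ?case
      unfolding y[symmetric] using Suc by simp
  qed simp
  \<comment> \<open>The \<open>Suc\<close> keeps \<open>m\<close> positive, so that
    \<open>x = a ^ (m - 1) * g\<close> below gives \<open>a * x = b * g\<close>.\<close>
  define m where "m = Suc (max k l)"
  define b where "b = a ^ m"
  define y' z' where "y' = y ^ m" and "z' = z ^ m"
  have bl: "b = a ^ (m - l) * a ^ l" and bk: "b = a ^ k * a ^ (m - k)"
    by (simp_all add: b_def m_def flip: power_add)
  have a_comm: "a ^ p * a ^ r = a ^ r * a ^ p" for p r
    by (rule power_commuting_commutes) (simp add: power_commutes)
  then have "a ^ (m - l) * b = b * a ^ (m - l)"
    by (simp only: b_def)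
  then have y': "b = b * b * y'"
    using Y[of m, folded b_def y'_def] bl by (metis mult.assoc)
  have "a ^ (k + m) = b * a ^ k"
    by (simp only: b_def power_add a_comm)
  then have z': "b = z' * b * b"
    using Z[of m, folded z'_def] bk by (metis mult.assoc)
  define g where "g = z' * b * y'"
  have e: "b * y' = z' * b"
    using y' z' by (metis mult.assoc)
  have "b * g = b * y'"
    unfolding g_def using y' e by (metis mult.assoc)
  moreover have "g * b = z' * b"
    unfolding g_def using z' e by (metis mult.assoc)
  ultimately have g: "b * g = g * b" "g * b * g = g" "b * g * b = b"
    using e z' by (simp, metis g_def mult.assoc, simp add: mult.assoc)
  have "drazin 1 b g"
    using g unfolding drazin_def by simp
  moreover have "a * b = b * a"
    by (simp add: b_def power_commutes)
  ultimately have ag: "a * g = g * a"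
    by (rule drazin_commute)
  define x where "x = a ^ (m - 1) * g"
  have ax: "a * x = b * g"
    by (simp add: x_def b_def m_def flip: mult.assoc)
  have comm: "a * x = x * a"
    using ag by (metis mult.assoc power_commutes x_def)
  have "x * a * x = a ^ (m - 1) * (g * b * g)"
    using ax by (metis mult.assoc x_def)
  then have "x * a * x = x"
    using g by (simp add: x_def)
  moreover have "a ^ k = z ^ (m - k) * b"
    using Z[of "m - k"] by (simp add: b_def m_def)
  then have "a ^ k * x * a = a ^ k"
    using ax g(1,3) comm by (metis mult.assoc)
  ultimately show ?thesis
    using comm unfolding drazin_def by blast
qed

lemma nilpotent_add:
  assumes "x * y = y * x" "x ^ i = 0" "y ^ j = 0"
  shows "(x + y) ^ (i + j) = 0"
proof -
  have xy: "y * x ^ n = x ^ n * y" for n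
    using assms(1) by (metis power_commuting_commutes)
  \<comment> \<open>Peeling off one factor \<open>x + y\<close> raises \<open>s\<close> or
    \<open>t\<close> by one and keeps the total degree \<open>m + s + t\<close>; this replaces the
    binomial expansion.\<close>
  have "(x + y) ^ m * x ^ s * y ^ t = 0" if "i + j \<le> m + s + t" for m s t
    using that
  proof (induction m arbitrary: s t)
    case 0
    then have "i \<le> s \<or> j \<le> t"
      by linarith
    then show ?case
      using assms(2,3) by (metis le_add_diff_inverse mult_zero_left mult_zero_right power_add)
  next
    case (Suc m)
    have "(x + y) ^ Suc m * x ^ s * y ^ t
      = (x + y) ^ m * x ^ Suc s * y ^ t + (x + y) ^ m * x ^ s * y ^ Suc t"
      unfolding power_Suc2[of "x + y" m] power_Suc[of x s] power_Suc[of y t]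
        distrib_left distrib_right
      by (metis mult.assoc xy)
    also have "\<dots> = 0"
      using Suc.IH[of "Suc s" t] Suc.IH[of s "Suc t"] Suc.prems by simp
    finally show ?case .
  qed
  from this[of "i + j" 0 0] show ?thesis
    by simp
qed

lemma power_mult_commuting:
  assumes "x * y = y * x"
  shows "(x * y) ^ n = x ^ n * y ^ n"
proof (induction n)
  case (Suc n)
  have "x ^ n * y = y * x ^ n"
    using assms by (metis power_commuting_commutes)
  with Suc show ?case
    by (simp add: mult.assoc) (metis mult.assoc)
qed simp

lemma power_mult_absorb:
  assumes "w * p = w"
  shows "(p * w) ^ Suc n = p * w ^ Suc n"
proof (induction n)
  case (Suc n)
  have "(p * w) ^ Suc (Suc n) = p * (w * p) * w ^ Suc n"
    by (subst power_Suc, subst Suc) (simp only: mult.assoc)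
  with assms show ?case
    by (simp add: mult.assoc)
qed simp

lemma idempotent_power: "f * f = f \<Longrightarrow> f ^ Suc n = f"
  by (induction n) auto

text \<open>The idempotent \<open>1 - a * x\<close> commutes with \<open>a\<close> and is killed by
  \<open>a ^ k\<close>. The exponent is \<open>Suc k\<close> because for \<open>k = 0\<close> the
  power would be \<open>1\<close>.\<close>

lemma drazin_nilpotent:
  assumes "drazin k a x"
  shows "(a * (1 - a * x)) ^ Suc k = 0"
proof -
  have ax: "a * x = x * a" "x * a * x = x" "a ^ k * (x * a) = a ^ k"
    using assms by (auto simp: drazin_def mult.assoc)
  have f: "(1 - a * x) * (1 - a * x) = 1 - a * x"
    using ax by (simp add: algebra_simps) (metis mult.assoc)
  have "a * (1 - a * x) = (1 - a * x) * a"
    using ax by (simp add: algebra_simps) (metis mult.assoc)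
  then have "(a * (1 - a * x)) ^ Suc k = a ^ Suc k * (1 - a * x) ^ Suc k"
    by (rule power_mult_commuting)
  also have "\<dots> = a * (a ^ k * (1 - a * x))"
    using idempotent_power[OF f] by (simp add: mult.assoc)
  also have "a ^ k * (1 - a * x) = 0"
    using ax by (simp add: right_diff_distrib)
  finally show ?thesis
    by simp
qed

lemma drazinI:
  assumes comm: "a * x = x * a" and inner: "x * a * x = x"
    and nil: "((1 - a * x) * a) ^ m = 0"
  shows "drazin m a x"
proof (cases m)
  \<comment> \<open>Here \<open>nil\<close> reads \<open>1 = 0\<close>, a contradiction.\<close>
  case 0
  with nil show ?thesis
    by simp
next
  case (Suc n)
  have f: "(1 - a * x) * (1 - a * x) = 1 - a * x"
    using comm inner by (simp add: algebra_simps) (metis mult.assoc)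
  have c: "(1 - a * x) * a = a * (1 - a * x)"
    using comm by (simp add: algebra_simps) (metis mult.assoc)
  then have "((1 - a * x) * a) ^ m = a ^ m * (1 - a * x) ^ m"
    by (metis power_mult_commuting)
  also have "\<dots> = a ^ m * (1 - a * x)"
    using idempotent_power[OF f] Suc by simp
  finally have "a ^ m - a ^ m * (a * x) = 0"
    using nil by (simp add: right_diff_distrib)
  then have "a ^ m * (a * x) = a ^ m"
    by simp
  with comm inner show ?thesis
    by (simp add: drazin_def mult.assoc)
qed

text \<open>\<open>c\<close> commutes with \<open>c * c\<close> and with \<open>u\<close>, hence
  with \<open>g\<close>, so \<open>c * c\<close> is a sum of the commuting nilpotents
  \<open>u * c\<close> and \<open>g\<close>.\<close>

lemma nilpotent_quadratic:
  assumes c: "c * c = u * c + g" and uc: "u * c = c * u" and ug: "u * g = g * u"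
    and "u ^ i = 0" "g ^ j = 0"
  shows "c ^ (2 * (i + j)) = 0"
proof -
  have "c * (u * c + g) = (u * c + g) * c"
    using c by (metis mult.assoc)
  then have "c * g = g * c"
    using uc by (simp add: distrib_left distrib_right mult.assoc)
  then have "(u * c) * g = g * (u * c)"
    using ug by (metis mult.assoc)
  moreover have "(u * c) ^ i = 0"
    using assms(4) power_mult_commuting[OF uc] by simp
  ultimately have "(u * c + g) ^ (i + j) = 0"
    using nilpotent_add assms(5) by blast
  with c show ?thesis
    unfolding power_mult power2_eq_square by simp
qed

text \<open>In an expanded power a word vanishes if some \<open>d\<close> is preceded by another
  letter; only \<open>c ^ Suc n\<close> and \<open>d * c ^ n\<close> survive.\<close>

lemma nilpotent_add_left_annihilator:
  assumes "c * d = 0" "d * d = 0" "c ^ m = 0"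
  shows "(c + d) ^ Suc m = 0"
proof -
  have "(c + d) ^ Suc n = c ^ Suc n + d * c ^ n" for n
  proof (induction n)
    case (Suc n)
    have "(c + d) ^ Suc (Suc n) = (c + d) * (c ^ Suc n + d * c ^ n)"
      by (subst power_Suc, subst Suc) simp
    also have "\<dots> = c ^ Suc (Suc n) + (c * d) * c ^ n + d * c ^ Suc n + (d * d) * c ^ n"
      by (simp add: distrib_left distrib_right mult.assoc add.assoc add.left_commute)
    finally show ?case
      using assms by simp
  qed simp
  then show ?thesis
    using assms(3) by simp
qed

section \<open>Words in \<open>a\<close>, \<open>x\<close>, \<open>b\<close>, \<open>y\<close> and
  \<open>s\<close>\<close>

context
  fixes a x b y s :: 'a and i j :: nat
  assumes x: "drazin i a x" and y: "drazin j b y"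
    and comm: "a * (1 - a * x) * b = b * a * (1 - a * x)"
    and zero: "b * a * (a * x) = 0"
    and s_rec: "s = x * (1 - b * y) + x * x * s * b"
    and s_nil: "s * b * y = 0"
begin

lemma a_x: "x * a = a * x" "a * x * x = x"
  and x_a_x: "x * a * x = x"
  using x unfolding drazin_def by (metis mult.assoc)+

lemma b_y: "y * b = b * y" "b * y * y = y"
  using y unfolding drazin_def by (metis mult.assoc)+

text \<open>\<open>x = a * (a * x) * x * x\<close>, so \<open>zero\<close> applies.\<close>

lemma b_x: "b * x = 0"
  using zero a_x by (metis mult.assoc mult_zero_left)

lemma b_a: "b * a = a * b - a * a * x * b"
proof -
  have "b * a * (1 - a * x) = b * a"
    using zero by (simp add: right_diff_distrib mult.assoc)
  then show ?thesis
    using comm by (simp add: right_diff_distrib left_diff_distrib mult.assoc)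
qed

lemma y_x: "y * x = 0"
  using b_x b_y by (metis mult.assoc mult_zero_right)

text \<open>The part \<open>a * (1 - a * x)\<close> commutes with \<open>b\<close>, hence with
  \<open>y\<close> by \<open>drazin_commute\<close>; the remaining part of \<open>a\<close> is
  killed by \<open>y\<close>.\<close>

lemma y_a: "y * a = a * y - a * a * x * y"
proof -
  define u where "u = a - a * a * x"
  have "b * (a * (a * x)) = 0"
    using zero by (simp add: mult.assoc)
  then have "u * b = b * u"
    using b_a by (simp add: u_def left_diff_distrib right_diff_distrib mult.assoc)
  then have "u * y = y * u"
    by (rule drazin_commute[OF y])
  moreover have "y * (a * (a * x)) = 0"
    using y_x a_x by (metis mult.assoc mult_zero_left)
  ultimately show ?thesis
    by (simp add: u_def left_diff_distrib right_diff_distrib mult.assoc)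
qed

lemma b_s: "b * s = 0"
  using b_x s_rec by (metis add_0 distrib_left mult.assoc mult_zero_left)

lemma a_x_s: "a * x * s = s"
proof -
  have "a * x * s = a * x * x * (1 - b * y) + a * x * x * x * s * b"
    by (subst s_rec) (simp add: distrib_left mult.assoc)
  then show ?thesis
    unfolding a_x(2) using s_rec by simp
qed

lemma s_y: "s * y = 0"
  using s_nil b_y by (metis mult.assoc mult_zero_left)

lemma y_s: "y * s = 0"
  using b_s b_y by (metis mult.assoc mult_zero_right)

lemma q_commute:
  assumes "c * b = b * c"
  shows "c * (1 - b * y) = (1 - b * y) * c"
proof -
  have "c * y = y * c"
    using assms by (rule drazin_commute[OF y])
  with assms show ?thesis
    by (simp add: left_diff_distrib right_diff_distrib) (metis mult.assoc)
qed

text \<open>With \<open>u = a * (1 - a * x)\<close>, \<open>x * u = 0\<close> and \<open>u\<close>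
  commutes with \<open>b\<close> and \<open>1 - b * y\<close>, so \<open>s_rec\<close> gives
  \<open>s * u = x * x * (s * u) * b\<close>. After \<open>j\<close> iterations the right-hand side
  contains \<open>s * b ^ j\<close>, which is zero by \<open>s_nil\<close>.\<close>

lemma s_u: "s * (a * (1 - a * x)) = 0"
proof -
  let ?u = "a * (1 - a * x)"
  have xu: "x * ?u = 0"
    using a_x x_a_x by (metis mult.assoc mult_1_right right_diff_distrib right_minus_eq)
  have ub: "b * ?u = ?u * b"
    using comm by (simp add: mult.assoc)
  have "s * ?u = x * ((1 - b * y) * ?u) + x * x * s * (b * ?u)"
    by (subst s_rec) (simp add: distrib_right mult.assoc)
  also have "\<dots> = x * (?u * (1 - b * y)) + x * x * s * (?u * b)"
    unfolding ub q_commute[OF ub[symmetric]] ..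
  also have "\<dots> = x * x * (s * ?u) * b"
    using xu by (metis add_0 mult.assoc mult_zero_left)
  finally have 1: "s * ?u = x * x * (s * ?u) * b" .
  have "s * ?u = (x * x) ^ n * (s * ?u) * b ^ n" for n
  proof (induction n)
    case (Suc n)
    have "(x * x) ^ Suc n * (s * ?u) * b ^ Suc n = (x * x) ^ n * (x * x * (s * ?u) * b) * b ^ n"
      by (simp add: power_Suc2[of "x * x"] mult.assoc del: power_Suc) (simp add: mult.assoc)
    with Suc 1 show ?case
      by simp
  qed simp
  moreover have "s * ?u * b ^ j = 0"
  proof -
    have "b ^ j * ?u = ?u * b ^ j"
      using ub by (metis power_commuting_commutes)
    moreover have "s * b ^ j = 0"
    proof -
      have "b ^ j = b * y * b ^ j"
        using y b_y unfolding drazin_def by (metis mult.assoc power_commutes power_commuting_commutes)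
      then show ?thesis
        using s_nil by (metis mult.assoc mult_zero_left)
    qed
    ultimately show ?thesis
      by (metis mult.assoc mult_zero_left)
  qed
  ultimately show ?thesis
    by (metis mult.assoc mult_zero_right)
qed

text \<open>By \<open>s_u\<close> only \<open>a * (a * x)\<close> contributes. Both \<open>b\<close>
  and \<open>y\<close> kill it, so \<open>s_rec\<close> leaves just its leading
  \<open>x\<close>.\<close>

lemma s_a: "s * a = a * x"
proof -
  have e: "b * (a * (a * x)) = 0" "y * (a * (a * x)) = 0"
    using zero b_y by (metis mult.assoc mult_zero_right)+
  have "s * (a * (a * x)) = x * (a * (a * x))"
    by (subst s_rec) (simp add: distrib_right left_diff_distrib mult.assoc e)
  also have "\<dots> = a * x"
    using a_x x_a_x by (metis mult.assoc)
  finally show ?thesis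
    using s_u by (simp add: right_diff_distrib mult.assoc)
qed

lemma a_s: "a * s = a * x - a * x * b * y + x * s * b"
proof -
  have "a * s = a * x * (1 - b * y) + a * x * x * s * b"
    by (subst s_rec) (simp add: distrib_left mult.assoc)
  then show ?thesis
    unfolding a_x(2) by (simp add: right_diff_distrib mult.assoc)
qed

lemma s_x: "s * x = x * x"
  using s_a a_x by (metis mult.assoc)

lemma s_s: "s * s = x * s"
  using s_a a_x_s a_x by (metis mult.assoc)

text \<open>This is \<open>s_rec\<close> solved for its last term; \<open>s_rec\<close> itself would
  loop as a rewrite rule.\<close>

lemma x_x_s_b: "x * x * s * b = s - x + x * b * y"
proof -
  have "x * x * s * b = s - x * (1 - b * y)"
    by (metis s_rec add_diff_cancel_left')
  then show ?thesis
    by (simp add: right_diff_distrib mult.assoc algebra_simps)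
qed

lemma y_b: "b * y = y * b" "y * y * b = y"
  using b_y by (metis mult.assoc)+

text \<open>Used from left to right as rewrite rules, these equations bring every product of \<open>a\<close>, \<open>x\<close>, \<open>b\<close>,
  \<open>y\<close>, \<open>s\<close> that occurs below to a normal form.\<close>

lemmas word_rules = a_x a_x_s x_a_x y_b b_x b_a y_x y_a b_s y_s s_y s_a a_s s_x s_s x_x_s_b

lemma a_part_nilpotent: "(a * (1 - a * x) * (1 - b * y)) ^ Suc i = 0"
proof -
  let ?u = "a * (1 - a * x)"
  have "?u * b = b * ?u"
    using comm by (simp add: mult.assoc)
  from power_mult_commuting[OF q_commute[OF this]] show ?thesis
    by (metis drazin_nilpotent[OF x] mult_zero_left)
qed

text \<open>Here \<open>1 - a * x\<close> is absorbed on the right of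
  \<open>b * (1 - b * y)\<close>, which stands in for commutation.\<close>

lemma b_part_nilpotent: "((1 - a * x) * (b * (1 - b * y))) ^ Suc j = 0"
proof -
  have "b * (a * x) = 0" "y * (a * x) = 0"
    using b_x y_x a_x(1) by (metis mult.assoc mult_zero_left)+
  then have "b * (1 - b * y) * (1 - a * x) = b * (1 - b * y)"
    by (simp add: right_diff_distrib left_diff_distrib mult.assoc)
  from power_mult_absorb[OF this] show ?thesis
    by (metis drazin_nilpotent[OF y] mult_zero_right)
qed

end

end

section \<open>Existence of Drazin inverses of matrices\<close>

lemma matrix_add_rdistrib: "((A::'a::semiring_1^'n^'m) + B) ** C = A ** C + B ** C"
  by (vector matrix_matrix_mult_def sum.distrib[symmetric] field_simps)

lemma matrix_diff_ldistrib: "(A::'a::ring_1^'n^'m) ** (B - C) = A ** B - A ** C"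
  by (vector matrix_matrix_mult_def sum_subtractf[symmetric] right_diff_distrib)

lemma matrix_diff_rdistrib: "((A::'a::ring_1^'n^'m) - B) ** C = A ** C - B ** C"
  by (vector matrix_matrix_mult_def sum_subtractf[symmetric] left_diff_distrib)

lemma matrix_minus_left: "(- (A::'a::ring_1^'n^'m)) ** B = - (A ** B)"
  and matrix_minus_right: "A ** (- B) = - (A ** B)"
  by (vector matrix_matrix_mult_def sum_negf)+

lemma matpow_commutes: "(A **^ k) ** A = A ** (A **^ k)"
  by (induction k) (simp_all flip: matrix_mul_assoc)

lemma matpow_commuting: "A ** B = B ** A \<Longrightarrow> (A **^ k) ** B = B ** (A **^ k)"
proof (induction k)
  case (Suc k)
  then show ?case
    by (metis matpow.simps(2) matrix_mul_assoc)
qed simp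

text \<open>The class predicate is proved for \<open>**\<close> explicitly, since \<open>*\<close>
  on this type is the entrywise product.\<close>

lemma matrix_ring_1:
  "class.ring_1 (mat 1 :: 'a::comm_ring_1^'n^'n) (**) (+) 0 (-) uminus"
  by standard
    (simp_all add: matrix_mul_assoc matrix_add_ldistrib matrix_add_rdistrib,
      simp add: mat_def vec_eq_iff)

lemma power_eq_matpow: "power.power (mat 1) (**) = (**^)"
proof (intro ext)
  show "power.power (mat 1) (**) A k = A **^ k" for A :: "'a::semiring_1^'n^'n" and k
    by (induction k) (simp_all add: power.power.simps)
qed

lemma drazin_eq_is_drazin_inverse:
  "ring_1.drazin (mat 1 :: 'a::comm_ring_1^'n^'n) (**) = is_drazin_inverse"
  by (intro ext) (simp add: ring_1.drazin_def[OF matrix_ring_1] is_drazin_inverse_def power_eq_matpow)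

lemmas matrix_ring_to_matrix = power_eq_matpow drazin_eq_is_drazin_inverse

lemmas is_drazin_inverse_exists = ring_1.drazin_exists[OF matrix_ring_1, unfolded matrix_ring_to_matrix]
  and is_drazin_inverse_unique = ring_1.drazin_unique[OF matrix_ring_1, unfolded matrix_ring_to_matrix]
  and is_drazin_inverse_power_left = ring_1.drazin_power_left[OF matrix_ring_1, unfolded matrix_ring_to_matrix]
  and is_drazin_inverseI = ring_1.drazinI[OF matrix_ring_1, unfolded matrix_ring_to_matrix]

section \<open>Row spaces, ranks and the index\<close>

lemma vector_matrix_in_span_rows:
  fixes M :: "'a::field^'n^'m"
  shows "c v* M \<in> vec.span (rows M)"
proof -
  have "c v* M = (\<Sum>i\<in>UNIV. c $ i *s row i M)"
    by (simp add: vec_eq_iff vector_matrix_mult_def row_def mult.commute)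
  also have "\<dots> \<in> vec.span (rows M)"
    by (intro vec.span_sum vec.span_scale vec.span_base) (auto simp: rows_def)
  finally show ?thesis .
qed

lemma span_rows_eq_range:
  fixes M :: "'a::field^'n^'m"
  shows "vec.span (rows M) = range (\<lambda>c. c v* M)"
proof
  have "rows M \<subseteq> range (\<lambda>c. c v* M)"
  proof
    fix r assume "r \<in> rows M"
    then obtain i where "r = row i M"
      by (auto simp: rows_def)
    then have "r = axis i 1 v* M"
      by (simp add: vec_eq_iff vector_matrix_mult_def row_def axis_def if_distrib[of "\<lambda>c. c * _"]
          if_distrib[of "(*) _"] cong: if_cong)
    then show "r \<in> range (\<lambda>c. c v* M)"
      by blast
  qed
  moreover have "vec.subspace (range (\<lambda>c. c v* M))"
    unfolding vec.subspace_def
  proof (intro conjI ballI allI)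
    show "0 \<in> range (\<lambda>c. c v* M)"
      by (rule range_eqI[of _ _ 0]) (simp add: vec_eq_iff vector_matrix_mult_def)
  next
    fix v w assume "v \<in> range (\<lambda>c. c v* M)" "w \<in> range (\<lambda>c. c v* M)"
    then obtain c d where "v = c v* M" "w = d v* M"
      by blast
    then have "v + w = (c + d) v* M"
      by (simp add: vec_eq_iff vector_matrix_mult_def distrib_right sum.distrib)
    then show "v + w \<in> range (\<lambda>c. c v* M)"
      by blast
  next
    fix k v assume "v \<in> range (\<lambda>c. c v* M)"
    then obtain c where "v = c v* M"
      by blast
    then have "k *s v = (k *s c) v* M"
      by (simp add: vec_eq_iff vector_matrix_mult_def sum_distrib_left mult_ac)
    then show "k *s v \<in> range (\<lambda>c. c v* M)"
      by blast
  qed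
  ultimately show "vec.span (rows M) \<subseteq> range (\<lambda>c. c v* M)"
    by (rule vec.span_minimal)
qed (auto intro: vector_matrix_in_span_rows)

lemma rows_mult_subset_span:
  fixes A :: "'a::field^'m^'l" and M :: "'a^'n^'m"
  shows "rows (A ** M) \<subseteq> vec.span (rows M)"
proof
  fix r assume "r \<in> rows (A ** M)"
  then obtain i where "r = row i (A ** M)"
    by (auto simp: rows_def)
  then have "r = (A $ i) v* M"
    by (simp add: vec_eq_iff vector_matrix_mult_def row_def matrix_matrix_mult_def mult.commute)
  then show "r \<in> vec.span (rows M)"
    using vector_matrix_in_span_rows by blast
qed

lemma rank_mult_le_right: "rank (A ** M) \<le> rank M"
  for A :: "'a::field^'m^'l" and M :: "'a^'n^'m"
  unfolding row_rank_def_gen using rows_mult_subset_span by (rule vec.dim_mono)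

text \<open>The row space of \<open>A ** M\<close> lies in that of \<open>M\<close>; equal
  dimensions make them equal. The coefficients expressing the rows of \<open>M\<close> by those of
  \<open>A ** M\<close> are the rows of \<open>Z\<close>.\<close>

lemma rank_mult_eq_imp_left_factor:
  fixes A :: "'a::field^'m^'l" and M :: "'a^'n^'m"
  assumes "rank (A ** M) = rank M"
  obtains Z where "M = Z ** (A ** M)"
proof -
  have "vec.span (rows (A ** M)) = vec.span (rows M)"
    by (metis assms order.refl rows_mult_subset_span row_rank_def_gen vec.dim_span
        vec.span_minimal vec.subspace_dim_equal vec.subspace_span)
  then have "\<exists>c. row i M = c v* (A ** M)" for i
    using span_rows_eq_range[of "A ** M"] vec.span_base[of "row i M" "rows M"]
    by (auto simp: rows_def)
  then obtain c where c: "\<And>i. row i M = c i v* (A ** M)"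
    by metis
  have "M = (\<chi> i. c i) ** (A ** M)"
  proof -
    have "M $ i $ j = ((\<chi> i. c i) ** (A ** M)) $ i $ j" for i j
      using arg_cong[OF c[of i], of "\<lambda>v. v $ j"]
      by (simp add: row_def vector_matrix_mult_def matrix_matrix_mult_def[of "\<chi> i. c i"] mult.commute)
    then show ?thesis
      by (simp add: vec_eq_iff)
  qed
  then show ?thesis
    by (rule that)
qed

lemma ind_rank: "rank (A **^ Suc (ind A)) = rank (A **^ ind A)"
proof -
  have "\<exists>k. rank (A **^ Suc k) \<ge> rank (A **^ k)"
  proof (rule ccontr)
    assume "\<nexists>k. rank (A **^ Suc k) \<ge> rank (A **^ k)"
    then have *: "rank (A **^ Suc k) < rank (A **^ k)" for k
      by (meson not_le)
    have "rank (A **^ k) + k \<le> rank (A **^ 0)" for k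
    proof (induction k)
      case (Suc k)
      then show ?case
        using *[of k] by linarith
    qed simp
    from this[of "Suc (rank (A **^ 0))"] show False
      by linarith
  qed
  then obtain k where "rank (A **^ k) = rank (A **^ (k + 1))"
    by (metis Suc_eq_plus1 matpow.simps(2) order.antisym rank_mult_le_right)
  then have "rank (A **^ ind A) = rank (A **^ (ind A + 1))"
    unfolding ind_def by (rule LeastI)
  then show ?thesis
    by simp
qed

lemma ind_left_factor:
  obtains Z where "A **^ ind A = Z ** (A **^ Suc (ind A))"
  using rank_mult_eq_imp_left_factor[of A "A **^ ind A"] ind_rank[of A] by auto

lemma transpose_matpow: "transpose (A **^ k) = transpose A **^ k"
  for A :: "'a::comm_ring_1^'n^'n"
  by (induction k) (simp_all add: matrix_transpose_mul matpow_commutes)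

text \<open>The right factorisation is obtained from the transpose. As \<open>drazin_exists\<close>
  allows two exponents, the indices of \<open>A\<close> and its transpose need not be
  compared.\<close>

lemma complex_drazin_exists: "\<exists>X. is_drazin_inverse (ind A) A X"
proof -
  obtain Z where Z: "A **^ ind A = Z ** (A **^ Suc (ind A))"
    by (rule ind_left_factor)
  let ?l = "ind (transpose A)"
  obtain Y where "transpose A **^ ?l = Y ** (transpose A **^ Suc ?l)"
    by (rule ind_left_factor)
  then have "A **^ ?l = (A **^ Suc ?l) ** transpose Y"
    by (metis matrix_transpose_mul transpose_matpow transpose_transpose)
  with Z show ?thesis
    by (rule is_drazin_inverse_exists)
qed

lemma complex_drazin: "is_drazin_inverse (ind A) A (complex_drazin A)"
  unfolding complex_drazin_def
  by (rule theI') (use complex_drazin_exists is_drazin_inverse_unique in blast)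

section \<open>Dual matrices by components\<close>

lemma std_part_sum: "std_part (\<Sum>i\<in>I. f i) = (\<Sum>i\<in>I. std_part (f i))"
  and inf_part_sum: "inf_part (\<Sum>i\<in>I. f i) = (\<Sum>i\<in>I. inf_part (f i))"
  by (induction I rule: infinite_finite_induct) (simp_all add: zero_dual_def plus_dual_def)

lemma mstd_nth: "mstd A $ i $ j = std_part (A $ i $ j)"
  and minf_nth: "minf A $ i $ j = inf_part (A $ i $ j)"
  by (simp_all add: mstd_def minf_def)

lemma mstd_mult: "mstd (A ** B) = mstd A ** mstd B"
  and minf_mult: "minf (A ** B) = mstd A ** minf B + minf A ** mstd B"
  by (simp_all add: vec_eq_iff mstd_nth minf_nth matrix_matrix_mult_def std_part_sum inf_part_sum
      times_dual_def sum.distrib)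

lemma mstd_one: "mstd (mat 1) = mat 1" and minf_one: "minf (mat 1) = 0"
  by (simp_all add: vec_eq_iff mstd_nth minf_nth mat_def zero_dual_def one_dual_def)

lemma dual_matrix_eqI: "mstd A = mstd B \<Longrightarrow> minf A = minf B \<Longrightarrow> A = B"
  by (simp add: vec_eq_iff mstd_nth minf_nth dual.expand)

definition dual_matrix :: "complex^'n^'m \<Rightarrow> complex^'n^'m \<Rightarrow> dual^'n^'m"
  where "dual_matrix X Y = (\<chi> i j. Dual (X $ i $ j) (Y $ i $ j))"

lemma dual_matrix_sel [simp]: "mstd (dual_matrix X Y) = X" "minf (dual_matrix X Y) = Y"
  by (simp_all add: vec_eq_iff mstd_nth minf_nth dual_matrix_def)

lemma mstd_matpow: "mstd (A **^ k) = mstd A **^ k"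
  by (induction k) (simp_all add: mstd_one mstd_mult)

lemma matrix_mult_sum_right: "A ** (\<Sum>i\<in>I. f i) = (\<Sum>i\<in>I. (A::'a::comm_ring_1^'n^'n) ** f i)"
  by (induction I rule: infinite_finite_induct) (simp_all add: matrix_add_ldistrib)

lemma matrix_mult_sum_left: "(\<Sum>i\<in>I. f i) ** A = (\<Sum>i\<in>I. f i ** (A::'a::comm_ring_1^'n^'n))"
  by (induction I rule: infinite_finite_induct) (simp_all add: matrix_add_rdistrib)

text \<open>The Leibniz rule for the \<open>eps\<close> part of a power. Its right-hand side is the
  middle factor in \<open>dual_drazin_invertible\<close>.\<close>

lemma minf_matpow:
  "minf (A **^ k) = (\<Sum>i=1..k. (mstd A **^ (k - i)) ** minf A ** (mstd A **^ (i - 1)))"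
proof (induction k)
  case (Suc k)
  have "mstd A ** ((mstd A **^ (k - i)) ** minf A ** (mstd A **^ (i - 1)))
    = (mstd A **^ (Suc k - i)) ** minf A ** (mstd A **^ (i - 1))" if "i \<in> {1..k}" for i
    using that by (simp add: Suc_diff_le matrix_mul_assoc)
  then have "mstd A ** minf (A **^ k)
    = (\<Sum>i=1..k. (mstd A **^ (Suc k - i)) ** minf A ** (mstd A **^ (i - 1)))"
    unfolding Suc matrix_mult_sum_right by (rule sum.cong[OF refl])
  then show ?case
    by (simp add: minf_mult mstd_matpow)
qed (simp add: minf_one)

lemma dual_drazin_exists:
  assumes "A \<in> dual_drazin_invertible"
  shows "\<exists>X. is_drazin_inverse (ind_s A) A X"
proof -
  define a a0 k X P S S' where "a = mstd A" and "a0 = minf A" and "k = ind a"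
    and "X = complex_drazin a" and "P = mat 1 - a ** X"
    and "S = minf (A **^ k)" and "S' = minf (A **^ Suc k)"
  have X: "is_drazin_inverse k a X"
    by (simp add: k_def X_def complex_drazin)
  then have aX: "a ** X = X ** a" and akX: "(a **^ k) ** X ** a = a **^ k"
    by (auto simp: is_drazin_inverse_def)
  have PSP: "P ** S ** P = 0"
    using assms
    by (simp add: dual_drazin_invertible_def Let_def S_def P_def X_def k_def a_def minf_matpow)
  have aP: "(a **^ k) ** P = 0" and Pa: "P ** (a **^ k) = 0"
  proof -
    show "(a **^ k) ** P = 0"
      using akX by (simp add: P_def matrix_diff_ldistrib aX matrix_mul_assoc)
    moreover have "a ** P = P ** a"
      by (simp add: P_def matrix_diff_ldistrib matrix_diff_rdistrib aX matrix_mul_assoc)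
    ultimately show "P ** (a **^ k) = 0"
      using matpow_commuting by metis
  qed
  have "a ** (X ** a) = X ** a ** a"
    by (metis aX matrix_mul_assoc)
  then have XaC: "(a **^ k) ** (X ** a) = X ** a ** (a **^ k)"
    by (rule matpow_commuting)
  have akX1: "(a **^ Suc k) ** X = a **^ k"
    unfolding matpow.simps matpow_commutes[symmetric]
    using akX by (simp add: aX flip: matrix_mul_assoc)
  have Xak1: "X ** (a **^ Suc k) = a **^ k"
    using akX XaC by (simp add: matrix_mul_assoc)
  note X_pow = is_drazin_inverse_power_left[OF X]
  have aX1: "(a **^ Suc k) ** (X **^ Suc k) = a ** X"
    by (simp only: matpow.simps(2)[of a] matrix_mul_assoc[symmetric] X_pow(2))
  have Xa1: "(X **^ Suc k) ** (a **^ Suc k) = a ** X"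
    by (simp only: matpow.simps(2)[of a] matpow_commutes[of a, symmetric] matrix_mul_assoc X_pow(1) aX)
  have MP: "M ** P = M - M ** a ** X" for M
    by (simp add: P_def matrix_diff_ldistrib matrix_mul_assoc)
  have PM: "P ** M = M - X ** a ** M" for M
    by (simp add: P_def matrix_diff_rdistrib aX)
  \<comment> \<open>The two ways of splitting one factor off \<open>A **^ Suc k\<close>;
    \<open>S'2\<close> serves the right factorisation, \<open>S'1\<close> the left one.\<close>
  have S'1: "S' = a ** S + a0 ** (a **^ k)"
    by (simp add: S'_def S_def a_def a0_def minf_mult mstd_matpow)
  have S'2: "S' = (a **^ k) ** a0 + S ** a"
    unfolding S'_def matpow.simps matpow_commutes[symmetric]
    by (simp add: S_def a_def a0_def minf_mult mstd_matpow)
  have Ak: "mstd (A **^ k) = a **^ k" "mstd (A **^ Suc k) = a **^ Suc k"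
    by (simp_all add: mstd_matpow a_def del: matpow.simps)
  \<comment> \<open>The \<open>eps\<close> part \<open>W\<close> of the witness must solve
    \<open>S = (a **^ Suc k) ** W + S' ** X\<close>. Applying \<open>X **^ Suc k\<close> to
    \<open>S - S' ** X\<close> solves it once \<open>P\<close> kills that difference, and
    \<open>P ** (S - S' ** X)\<close> equals \<open>P ** S ** P\<close>.\<close>
  have right: "A **^ k = (A **^ Suc k) ** dual_matrix X ((X **^ Suc k) ** (S - S' ** X))"
  proof (rule dual_matrix_eqI)
    have "P ** (S - S' ** X) = P ** S ** P - (P ** (a **^ k)) ** a0 ** X"
      by (simp add: S'2 MP matrix_diff_ldistrib matrix_add_ldistrib matrix_add_rdistrib
          matrix_mul_assoc algebra_simps)
    then have "S = a ** X ** (S - S' ** X) + S' ** X"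
      by (simp add: PSP Pa) (simp add: P_def matrix_diff_rdistrib algebra_simps)
    then show "minf (A **^ k) = minf ((A **^ Suc k) ** dual_matrix X ((X **^ Suc k) ** (S - S' ** X)))"
      unfolding minf_mult dual_matrix_sel Ak S_def[symmetric] S'_def[symmetric] matrix_mul_assoc aX1 .
  qed (simp only: mstd_mult dual_matrix_sel Ak akX1)
  have left: "A **^ k = dual_matrix X ((S - X ** S') ** (X **^ Suc k)) ** (A **^ Suc k)"
  proof (rule dual_matrix_eqI)
    have "(S - X ** S') ** P = P ** S ** P - X ** a0 ** ((a **^ k) ** P)"
      by (simp add: S'1 PM matrix_diff_rdistrib matrix_add_ldistrib matrix_add_rdistrib
          flip: matrix_mul_assoc)
    then have "S = X ** S' + (S - X ** S') ** (a ** X)"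
      by (simp add: PSP aP) (simp add: P_def matrix_diff_ldistrib algebra_simps)
    then show "minf (A **^ k) = minf (dual_matrix X ((S - X ** S') ** (X **^ Suc k)) ** (A **^ Suc k))"
      unfolding minf_mult dual_matrix_sel Ak S_def[symmetric] S'_def[symmetric]
        matrix_mul_assoc[symmetric] Xa1 .
  qed (simp only: mstd_mult dual_matrix_sel Ak Xak1)
  show ?thesis
    using is_drazin_inverse_exists[OF left right] by (simp add: ind_s_def k_def a_def)
qed

lemma dual_drazin: "A \<in> dual_drazin_invertible \<Longrightarrow> is_drazin_inverse (ind_s A) A A\<^sup>D"
  unfolding dual_drazin_def
  by (rule theI') (use dual_drazin_exists is_drazin_inverse_unique in blast)

text \<open>Membership makes \<open>A\<^sup>D\<close> a genuine Drazin inverse; uniqueness then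
  permits any exponent \<open>m\<close>.\<close>

lemma dual_drazin_eqI:
  assumes "A \<in> dual_drazin_invertible" "is_drazin_inverse m A X"
  shows "A\<^sup>D = X"
  using dual_drazin[OF assms(1)] assms(2) by (rule is_drazin_inverse_unique)

section \<open>Block matrices\<close>

lemma block_matrix_mult:
  "block_matrix A B C D ** block_matrix A' B' C' D' = block_matrix
    (A ** A' + B ** C') (A ** B' + B ** D') (C ** A' + D ** C') (C ** B' + D ** D')"
proof -
  have "(\<Sum>k\<in>UNIV. f k) = (\<Sum>k\<in>UNIV. f (Inl k)) + (\<Sum>k\<in>UNIV. f (Inr k))" for f :: "'b + 'b \<Rightarrow> 'a"
    by (simp add: sum.Plus flip: UNIV_Plus_UNIV)
  then show ?thesis
    by (simp add: vec_eq_iff block_matrix_def matrix_matrix_mult_def split: sum.split)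
qed

lemma block_matrix_add:
  "block_matrix A B C D + block_matrix A' B' C' D' = block_matrix (A + A') (B + B') (C + C') (D + D')"
  by (simp add: vec_eq_iff block_matrix_def split: sum.split)

lemma block_matrix_diff:
  "block_matrix A B C D - block_matrix A' B' C' D' = block_matrix (A - A') (B - B') (C - C') (D - D')"
  for A :: "'a::group_add^'n^'n"
  by (simp add: vec_eq_iff block_matrix_def split: sum.split)

lemma block_matrix_zero: "block_matrix 0 0 0 0 = 0"
  by (simp add: vec_eq_iff block_matrix_def split: sum.split)

lemma block_matrix_one: "block_matrix (mat 1) 0 0 (mat 1) = mat 1"
  by (auto simp add: vec_eq_iff block_matrix_def mat_def split: sum.split)

lemma block_diagonal_matpow: "block_matrix A 0 0 D **^ k = block_matrix (A **^ k) 0 0 (D **^ k)"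
  by (induction k) (simp_all add: block_matrix_mult block_matrix_one)

lemmas matrix_nilpotent_quadratic =
    ring_1.nilpotent_quadratic[OF matrix_ring_1, unfolded matrix_ring_to_matrix]
  and matrix_nilpotent_add_left_annihilator =
    ring_1.nilpotent_add_left_annihilator[OF matrix_ring_1, unfolded matrix_ring_to_matrix]
  and matrix_word_rules = ring_1.word_rules[OF matrix_ring_1, unfolded matrix_ring_to_matrix]
  and matrix_a_part_nilpotent = ring_1.a_part_nilpotent[OF matrix_ring_1, unfolded matrix_ring_to_matrix]
  and matrix_b_part_nilpotent = ring_1.b_part_nilpotent[OF matrix_ring_1, unfolded matrix_ring_to_matrix]

lemma block_drazin_inverse:
  fixes A B X Y S :: "'a::comm_ring_1^'n^'n"
  assumes X: "is_drazin_inverse i A X" and Y: "is_drazin_inverse j B Y"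
    and comm: "A ** (mat 1 - A ** X) ** B = B ** A ** (mat 1 - A ** X)"
    and zero: "B ** A ** (A ** X) = 0"
    and S_rec: "S = X ** (mat 1 - B ** Y) + X ** X ** S ** B"
    and S_nil: "S ** B ** Y = 0"
  shows "\<exists>m. is_drazin_inverse m (block_matrix A B (mat 1) 0)
    (block_matrix S (B ** Y - A ** X ** B ** Y + X ** S ** B)
      (X ** S + Y - A ** X ** Y) (S - X - A ** Y + A ** A ** X ** Y))"
    (is "\<exists>m. is_drazin_inverse m ?N ?V")
proof -
  note word = matrix_word_rules[OF X Y comm zero S_rec S_nil, folded matrix_mul_assoc]
  \<comment> \<open>Products are nested to the right, so each word rule is also needed with a
    trailing factor.\<close>
  have ext: "L ** M = R ** M" if "L = R" for L M R :: "'a^'n^'n"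
    using that by simp
  note reduce = word word[THEN ext, folded matrix_mul_assoc]
    matrix_add_ldistrib matrix_add_rdistrib matrix_diff_ldistrib matrix_diff_rdistrib
    matrix_minus_left matrix_minus_right add_ac add_diff_eq diff_add_eq diff_diff_eq diff_diff_eq2
  define U where "U = A ** (mat 1 - A ** X) ** (mat 1 - B ** Y)"
  define G where "G = (mat 1 - A ** X) ** (B ** (mat 1 - B ** Y))"
  define E where "E = (mat 1 - A ** X) ** (mat 1 - B ** Y)"
  \<comment> \<open>\<open>D\<close> collects the terms of the remainder that contain
    \<open>S\<close>; \<open>C\<close> collects the others.\<close>
  define C where "C = block_matrix U G E 0"
  define D where "D = block_matrix (- (S ** B)) (- (X ** S ** B ** B)) (- (X ** S ** B)) (- (S ** B))"
  have NV: "?N ** ?V = ?V ** ?N"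
    by (simp add: block_matrix_mult reduce flip: matrix_mul_assoc)
  have VNV: "?V ** ?N ** ?V = ?V"
    by (simp add: block_matrix_mult reduce flip: matrix_mul_assoc)
  have split: "(mat 1 - ?N ** ?V) ** ?N = C + D"
    unfolding C_def D_def U_def G_def E_def block_matrix_one[symmetric]
    by (simp add: block_matrix_mult block_matrix_diff block_matrix_add reduce flip: matrix_mul_assoc)
  \<comment> \<open>Up to sign, every entry of \<open>D\<close> begins with \<open>S\<close> or
    \<open>X\<close>, which \<open>U\<close>, \<open>G\<close> and \<open>E\<close> annihilate, and
    ends in \<open>B\<close>, which annihilates \<open>S\<close> and \<open>X\<close>.\<close>
  have CD: "C ** D = 0" "D ** D = 0"
    unfolding C_def D_def U_def G_def E_def block_matrix_zero[symmetric]
    by (simp_all add: block_matrix_mult reduce flip: matrix_mul_assoc)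
  \<comment> \<open>The Cayley-Hamilton identity of a two by two matrix, with \<open>E\<close>
    acting as identity on \<open>G\<close>; the scalars \<open>U\<close> and \<open>G\<close> become
    block diagonal.\<close>
  have "C ** C = block_matrix U 0 0 U ** C + block_matrix G 0 0 G"
    "block_matrix U 0 0 U ** C = C ** block_matrix U 0 0 U"
    "block_matrix U 0 0 U ** block_matrix G 0 0 G = block_matrix G 0 0 G ** block_matrix U 0 0 U"
    unfolding C_def U_def G_def E_def
    by (simp_all add: block_matrix_mult block_matrix_add reduce flip: matrix_mul_assoc)
  moreover have "block_matrix U 0 0 U **^ Suc i = 0" "block_matrix G 0 0 G **^ Suc j = 0"
    unfolding block_diagonal_matpow U_def G_def matrix_a_part_nilpotent[OF X Y comm zero S_rec S_nil]
      matrix_b_part_nilpotent[OF X Y comm zero S_rec S_nil] block_matrix_zero by (rule refl)+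
  ultimately have "C **^ (2 * (Suc i + Suc j)) = 0"
    by (rule matrix_nilpotent_quadratic)
  with CD have "(C + D) **^ Suc (2 * (Suc i + Suc j)) = 0"
    by (rule matrix_nilpotent_add_left_annihilator)
  then show ?thesis
    using is_drazin_inverseI[OF NV VNV] split by metis
qed

theorem theorem3p2:
  fixes A B :: "dual^'n^'n"
    and N :: "dual^('n + 'n)^('n + 'n)"
    and iA iB :: nat
  assumes N_def: "N = block_matrix A B (mat 1) 0"
    and N_inv: "N \<in> dual_drazin_invertible"
    and A_inv: "A \<in> dual_drazin_invertible"
    and B_inv: "B \<in> dual_drazin_invertible"
    and iA: "ind_s A = iA"
    and iB: "ind_s B = iB"
    and comm: "A ** A\<^sup>\<pi> ** B = B ** A ** A\<^sup>\<pi>"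
    and zero: "B ** A ** A\<^sup>e = 0"
  shows "N\<^sup>D = block_matrix
      (\<Sum>i<iB. (A\<^sup>D **^ (2 * i + 1)) ** B\<^sup>\<pi> ** (B **^ i))
      (A\<^sup>\<pi> ** B ** B\<^sup>D + (\<Sum>i<iB. (A\<^sup>D **^ (2 * i + 2)) ** B\<^sup>\<pi> ** (B **^ (i + 1))))
      ((\<Sum>i<iB. (A\<^sup>D **^ (2 * i + 2)) ** B\<^sup>\<pi> ** (B **^ i)) + A\<^sup>\<pi> ** B\<^sup>D)
      (- (A ** A\<^sup>\<pi> ** B\<^sup>D) - A\<^sup>D ** B\<^sup>e
        + (\<Sum>i<iB. (A\<^sup>D **^ (2 * i + 3)) ** B\<^sup>\<pi> ** (B **^ (i + 1))))"
proof -
  define X Y Q where "X = A\<^sup>D" and "Y = B\<^sup>D" and "Q = mat 1 - B ** Y"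
  define f where "f i = (X **^ (2 * i + 1)) ** Q ** (B **^ i)" for i
  define S where "S = (\<Sum>i<iB. f i)"
  have pi: "A\<^sup>\<pi> = mat 1 - A ** X" "A\<^sup>e = A ** X" "B\<^sup>\<pi> = Q" "B\<^sup>e = B ** Y"
    by (simp_all add: dual_drazin_pi_def dual_drazin_e_def X_def Y_def Q_def)
  have X: "is_drazin_inverse iA A X" and Y: "is_drazin_inverse iB B Y"
    using dual_drazin[OF A_inv] dual_drazin[OF B_inv] by (simp_all add: iA iB X_def Y_def)
  then have BY: "B ** Y = Y ** B" and YBY: "Y ** B ** Y = Y" and BiB: "(B **^ iB) ** Y ** B = B **^ iB"
    by (simp_all add: is_drazin_inverse_def)
  have B_BY: "(B **^ i) ** (B ** Y) = B ** Y ** (B **^ i)" for i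
    by (rule matpow_commuting) (metis BY matrix_mul_assoc)
  have QBY: "Q ** (B ** Y) = 0"
    by (simp add: Q_def matrix_diff_rdistrib) (metis YBY matrix_mul_assoc)
  have QB: "Q ** (B **^ iB) = 0"
    using BiB B_BY[of iB] by (simp add: Q_def matrix_diff_rdistrib BY flip: matrix_mul_assoc)
  have S_X: "X ** S = (\<Sum>i<iB. (X **^ (2 * i + 2)) ** Q ** (B **^ i))"
    by (simp add: S_def f_def matrix_mult_sum_right matrix_mul_assoc)
  have S_XB: "X ** S ** B = (\<Sum>i<iB. (X **^ (2 * i + 2)) ** Q ** (B **^ (i + 1)))"
    by (simp add: S_X matrix_mult_sum_left matpow_commutes flip: matrix_mul_assoc)
  have S_XXB: "X ** X ** S ** B = (\<Sum>i<iB. (X **^ (2 * i + 3)) ** Q ** (B **^ (i + 1)))"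
    using arg_cong[OF S_XB, of "(**) X"]
    by (simp add: matrix_mult_sum_right matrix_mul_assoc numeral_3_eq_3)
  \<comment> \<open>The two outer multiplications shift the index of \<open>f\<close> by one, so
    \<open>S\<close> loses \<open>f 0 = X ** Q\<close> and gains \<open>f iB\<close>, which vanishes
    because \<open>Q\<close> kills \<open>B **^ iB\<close>.\<close>
  also have "\<dots> = (\<Sum>i<iB. f (Suc i))"
    by (simp add: f_def numeral_3_eq_3)
  also have "\<dots> = S + f iB - f 0"
    unfolding S_def using sum.lessThan_Suc_shift[of f iB] by (simp add: algebra_simps)
  also have "f iB = 0"
    by (simp add: f_def QB flip: matrix_mul_assoc)
  also have "f 0 = X ** Q"
    by (simp add: f_def)
  finally have S_rec: "S = X ** Q + X ** X ** S ** B"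
    by simp
  \<comment> \<open>\<open>B ** Y\<close> moves left past \<open>B **^ i\<close> until it meets
    \<open>Q\<close>.\<close>
  have "f i ** (B ** Y) = 0" for i
  proof -
    have "Q ** ((B **^ i) ** (B ** Y)) = 0"
      by (simp only: B_BY matrix_mul_assoc[of Q "B ** Y"] QBY times0_left)
    then show ?thesis
      by (simp add: f_def flip: matrix_mul_assoc)
  qed
  then have S_nil: "S ** B ** Y = 0"
    by (simp add: S_def matrix_mult_sum_left flip: matrix_mul_assoc)
  obtain m where "is_drazin_inverse m N
    (block_matrix S (B ** Y - A ** X ** B ** Y + X ** S ** B)
      (X ** S + Y - A ** X ** Y) (S - X - A ** Y + A ** A ** X ** Y))"
    using block_drazin_inverse[OF X Y _ _ S_rec[unfolded Q_def] S_nil] comm zero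
    unfolding N_def pi by blast
  then have "N\<^sup>D = block_matrix S (B ** Y - A ** X ** B ** Y + X ** S ** B)
      (X ** S + Y - A ** X ** Y) (S - X - A ** Y + A ** A ** X ** Y)"
    by (rule dual_drazin_eqI[OF N_inv])
  also have "B ** Y - A ** X ** B ** Y + X ** S ** B = A\<^sup>\<pi> ** B ** B\<^sup>D + X ** S ** B"
    by (simp add: pi matrix_diff_rdistrib flip: Y_def)
  also have "X ** S + Y - A ** X ** Y = X ** S + A\<^sup>\<pi> ** B\<^sup>D"
    by (simp add: pi matrix_diff_rdistrib flip: Y_def)
  also have "S - X - A ** Y + A ** A ** X ** Y
    = - (A ** A\<^sup>\<pi> ** B\<^sup>D) - A\<^sup>D ** B\<^sup>e + X ** X ** S ** B"
  proof -
    \<comment> \<open>The displayed entry has its sum start at the third power of \<open>X\<close>;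
      the recursion trades this sum for \<open>S\<close>.\<close>
    have "X ** X ** S ** B = S - X ** Q"
      using S_rec by (metis add_diff_cancel_left')
    then have "X ** X ** S ** B = S - X + X ** (B ** Y)"
      by (simp add: Q_def matrix_diff_ldistrib)
    then show ?thesis
      by (simp add: pi matrix_diff_rdistrib matrix_diff_ldistrib matrix_mul_assoc flip: X_def Y_def)
  qed
  finally show ?thesis
    unfolding S_XXB pi unfolding S_XB unfolding S_X unfolding S_def f_def X_def .
qed

end
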